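(* Let $\hat{B}_k[\cdot]$ be the (symmetric) nonlinear AMLI-cycle multigrid operator and let $\tilde{B}_k[\cdot]$ be given by $n\ge1$ steps of the (full) nonlinear PCG method with $\hat{B}_k[\cdot]$ as the preconditioner. Assume that the convergence factor of the two-grid method is bounded by some $\bar\delta\in[0,1)$ independent of $k$, i.e. $\|(I-P_{k-1})(I-R_kA_k)v\|_{A_k}^2\le\bar\delta\,\|v\|_{A_k}^2$ for all $2\le k\le J$ and all $v\in V_k$. Let $n$ be chosen such that the inequality $$(1-\delta^n)\bar{\delta} + \delta^n \leq \delta$$ has a solution $\delta\in[0,1)$; a sufficient condition for the existence of such a solution is $n>\frac{1}{1-\bar\delta}$. Then, for such a $\delta$ (independent of $k$), for every $k\in\{1,\dots,J\}$ and every $v\in V_k$, $$\| v - \hat{B}_k[A_kv] \|_{A_k}^2 \leq \delta \| v \|_{A_k}^2,\qquad \| v - \tilde{B}_k[A_kv] \|_{A_k}^2 \leq \delta^n \| v \|_{A_k}^2.$$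
   Context: Setting. $V$ is a finite-dimensional real vector space with inner product $(\cdot,\cdot)$ and norm $\|\cdot\|$; $A:V\to V$ is symmetric positive definite (SPD) with respect to $(\cdot,\cdot)$; $(u,v)_A=(Au,v)$. $V_1\subset V_2\subset\cdots\subset V_J=V$ are nested subspaces. $Q_k,P_k:V\to V_k$ are the orthogonal projections with respect to $(\cdot,\cdot)$ and $(\cdot,\cdot)_A$. $A_k:V_k\to V_k$ is defined by $(A_ku_k,v_k)=(u_k,v_k)_A$ for $u_k,v_k\in V_k$; it is SPD, $(u,v)_{A_k}=(A_ku,v)$, with norm $\|\cdot\|_{A_k}$ (also used for the induced operator norm). $R_k:V_k\to V_k$ ($2\le k\le J$) are given linear smoothers, always assumed convergent: $\|I-R_kA_k\|_{A_k}<1$; $R_k^t$ is the adjoint of $R_k$ with respect to $(\cdot,\cdot)$. The two-grid method at level $k$ is smoothing by $R_k$ (and $R_k^t$ as post-smoother) combined with exact solution at level $k-1$; its error operator is $(I-R_k^tA_k)(I-P_{k-1})(I-R_kA_k)$, whose $A_k$-operator norm equals $\|(I-P_{k-1})(I-R_kA_k)\|_{A_k}^2$. Nonlinear PCG ($n$ steps, full version, $n\ge1$ fixed) on $V_k$ with a given, possibly nonlinear, preconditioner $\hat B_k[\cdot]:V_k\to V_k$: for $f\in V_k$ put $u_0=0$, $r_0=f$, $p_0=\hat B_k[r_0]$; for $i=1,\dots,n-1$, $p_i=\hat B_k[r_i]+\sum_{j=0}^{i-1}\beta_{i,j}p_j$ with $\beta_{i,j}=-(\hat B_k[r_i],p_j)_{A_k}/(p_j,p_j)_{A_k}$;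 for $i=0,\dots,n-1$, $\alpha_i=(r_i,p_i)/(p_i,p_i)_{A_k}$, $u_{i+1}=u_i+\alpha_ip_i$, $r_{i+1}=r_i-\alpha_iA_kp_i$. The output is $\tilde B_k[f]:=u_n$. Convention: a coefficient $\alpha_i$ or $\beta_{i,j}$ whose denominator vanishes is taken to be $0$. Nonlinear AMLI-cycle: $\hat B_1[f]=A_1^{-1}f$ and, for $k\ge2$, $f\in V_k$: $u_1=R_kf$, $u_2=u_1+\tilde B_{k-1}[Q_{k-1}(f-A_ku_1)]$, $\hat B_k[f]=u_2+R_k^t(f-A_ku_2)$, where on each level $\tilde B_{j}[\cdot]$ is the operator produced by $n$ steps of nonlinear PCG on $V_{j}$ with preconditioner $\hat B_{j}[\cdot]$. *)

theory Defs
  imports "HOL-Analysis.Analysis"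
begin

definition SPD :: "('a::euclidean_space \<Rightarrow> 'a) \<Rightarrow> bool" where
  "SPD A \<longleftrightarrow> linear A \<and> (\<forall>x y. A x \<bullet> y = x \<bullet> A y) \<and> (\<forall>x. x \<noteq> 0 \<longrightarrow> 0 < A x \<bullet> x)"

definition energy_inner :: "('a::euclidean_space \<Rightarrow> 'a) \<Rightarrow> 'a \<Rightarrow> 'a \<Rightarrow> real" where
  "energy_inner A u v = A u \<bullet> v"

definition energy_norm :: "('a::euclidean_space \<Rightarrow> 'a) \<Rightarrow> 'a \<Rightarrow> real" where
  "energy_norm A u = sqrt (energy_inner A u u)"

text \<open>Operators on a subspace \<open>W\<close> are total functions of which only the values on \<open>W\<close>
  are meaningful.\<close>

definition linear_on :: "'a::euclidean_space set \<Rightarrow> ('a \<Rightarrow> 'a) \<Rightarrow> bool" where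
  "linear_on W T \<longleftrightarrow> T ` W \<subseteq> W \<and>
     (\<forall>x\<in>W. \<forall>y\<in>W. T (x + y) = T x + T y) \<and> (\<forall>c. \<forall>x\<in>W. T (c *\<^sub>R x) = c *\<^sub>R T x)"

text \<open>As in the library's \<^const>\<open>onorm\<close>, the zero vector contributes the quotient \<open>0 / 0 = 0\<close>,
  so the norm is \<open>0\<close> on the trivial space.\<close>

definition onorm_on :: "'a::euclidean_space set \<Rightarrow> ('a \<Rightarrow> real) \<Rightarrow> ('a \<Rightarrow> 'a) \<Rightarrow> real" where
  "onorm_on W nrm T = (SUP v\<in>W. nrm (T v) / nrm v)"

definition adjoint_on :: "'a::euclidean_space set \<Rightarrow> ('a \<Rightarrow> 'a) \<Rightarrow> 'a \<Rightarrow> 'a" where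
  "adjoint_on W T y = (THE z. z \<in> W \<and> (\<forall>x\<in>W. T x \<bullet> y = x \<bullet> z))"

definition orth_proj :: "('a::euclidean_space \<Rightarrow> 'a \<Rightarrow> real) \<Rightarrow> 'a set \<Rightarrow> 'a \<Rightarrow> 'a" where
  "orth_proj ip W x = (THE w. w \<in> W \<and> (\<forall>v\<in>W. ip (x - w) v = 0))"

definition level_op :: "('a::euclidean_space \<Rightarrow> 'a) \<Rightarrow> (nat \<Rightarrow> 'a set) \<Rightarrow> nat \<Rightarrow> 'a \<Rightarrow> 'a" where
  "level_op A V k u = (THE w. w \<in> V k \<and> (\<forall>v\<in>V k. w \<bullet> v = energy_inner A u v))"

text \<open>Nonlinear PCG for the operator \<open>A\<close>, preconditioner \<open>B\<close> and right-hand side \<open>f\<close>: residuals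
  \<open>r\<^sub>i\<close>, directions \<open>p\<^sub>i\<close> and iterates \<open>u\<^sub>i\<close>. Since \<open>x / 0 = 0\<close>, a coefficient whose denominator
  vanishes is \<open>0\<close>.\<close>

function pcg_res :: "('a::euclidean_space \<Rightarrow> 'a) \<Rightarrow> ('a \<Rightarrow> 'a) \<Rightarrow> 'a \<Rightarrow> nat \<Rightarrow> 'a"
  and pcg_dir :: "('a::euclidean_space \<Rightarrow> 'a) \<Rightarrow> ('a \<Rightarrow> 'a) \<Rightarrow> 'a \<Rightarrow> nat \<Rightarrow> 'a" where
  "pcg_res A B f 0 = f"
| "pcg_res A B f (Suc i) = pcg_res A B f i
     - ((pcg_res A B f i \<bullet> pcg_dir A B f i)
          / energy_inner A (pcg_dir A B f i) (pcg_dir A B f i)) *\<^sub>R A (pcg_dir A B f i)"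
| "pcg_dir A B f i = B (pcg_res A B f i)
     + (\<Sum>j<i. (- energy_inner A (B (pcg_res A B f i)) (pcg_dir A B f j)
                 / energy_inner A (pcg_dir A B f j) (pcg_dir A B f j)) *\<^sub>R pcg_dir A B f j)"
  by pat_completeness auto
termination
  by (relation "Wellfounded.measure (\<lambda>x. case x of Inl (A, B, f, i) \<Rightarrow> 2 * i | Inr (A, B, f, i) \<Rightarrow> Suc (2 * i))")
    auto

declare pcg_dir.simps [simp del]

primrec pcg_iter :: "('a::euclidean_space \<Rightarrow> 'a) \<Rightarrow> ('a \<Rightarrow> 'a) \<Rightarrow> 'a \<Rightarrow> nat \<Rightarrow> 'a" where
  "pcg_iter A B f 0 = 0"
| "pcg_iter A B f (Suc i) = pcg_iter A B f i
     + ((pcg_res A B f i \<bullet> pcg_dir A B f i)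
          / energy_inner A (pcg_dir A B f i) (pcg_dir A B f i)) *\<^sub>R pcg_dir A B f i"

definition nonlinear_pcg ::
    "nat \<Rightarrow> ('a::euclidean_space \<Rightarrow> 'a) \<Rightarrow> ('a \<Rightarrow> 'a) \<Rightarrow> 'a \<Rightarrow> 'a" where
  "nonlinear_pcg n A B f = pcg_iter A B f n"

text \<open>Levels are numbered from \<open>1\<close>; the value at level \<open>0\<close> is irrelevant.\<close>

fun amli :: "('a::euclidean_space \<Rightarrow> 'a) \<Rightarrow> (nat \<Rightarrow> 'a set) \<Rightarrow> (nat \<Rightarrow> 'a \<Rightarrow> 'a) \<Rightarrow> nat \<Rightarrow> nat
    \<Rightarrow> 'a \<Rightarrow> 'a" where
  "amli A V R n k =
     (if k \<le> 1 then inv_into (V 1) (level_op A V 1)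
      else (\<lambda>f.
        let u1 = R k f;
            u2 = u1 + nonlinear_pcg n (level_op A V (k - 1)) (amli A V R n (k - 1))
                        (orth_proj inner (V (k - 1)) (f - level_op A V k u1))
        in u2 + adjoint_on (V k) (R k) (f - level_op A V k u2)))"

declare amli.simps [simp del]

definition amli_pcg :: "('a::euclidean_space \<Rightarrow> 'a) \<Rightarrow> (nat \<Rightarrow> 'a set) \<Rightarrow> (nat \<Rightarrow> 'a \<Rightarrow> 'a) \<Rightarrow> nat
    \<Rightarrow> nat \<Rightarrow> 'a \<Rightarrow> 'a" where
  "amli_pcg A V R n k = nonlinear_pcg n (level_op A V k) (amli A V R n k)"

end

theory Submission
  imports Defs
begin

text \<open>With \<open>w = (I - R\<^sub>k A\<^sub>k) v\<close>, the error after the inexact coarse correction is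
  \<open>(w - P w) + (P w - x)\<close>, where \<open>P\<close> is the energy projection onto the coarser level and \<open>x\<close> is the
  nonlinear PCG approximation of \<open>P w\<close>. The summands are energy-orthogonal, the first is controlled
  by the two-grid bound and the second by \<open>\<delta>\<^sup>n \<parallel>P w\<parallel>\<^sup>2\<close>; since pre- and post-smoothing are
  contractions, the squared error is at most \<open>((1 - \<delta>\<^sup>n) c + \<delta>\<^sup>n) \<parallel>v\<parallel>\<^sup>2\<close> for the
  two-grid constant \<open>c\<close>. A PCG step reduces the error at least as much as a step of the preconditioner,
  because the new error is energy-orthogonal to all previous directions.\<close>

section \<open>Bilinearity of energy forms\<close>

lemma energy_inner_linear:
  assumes "linear L"
  shows "energy_inner L (x + y) z = energy_inner L x z + energy_inner L y z"
    and "energy_inner L (x - y) z = energy_inner L x z - energy_inner L y z"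
    and "energy_inner L (c *\<^sub>R x) z = c * energy_inner L x z"
    and "energy_inner L z (x + y) = energy_inner L z x + energy_inner L z y"
    and "energy_inner L z (x - y) = energy_inner L z x - energy_inner L z y"
    and "energy_inner L z (c *\<^sub>R x) = c * energy_inner L z x"
    and "energy_inner L 0 z = 0"
    and "energy_inner L z 0 = 0"
  using assms
  by (simp_all add: energy_inner_def linear_add linear_diff linear_scale linear_0
      inner_add_left inner_add_right inner_diff_left inner_diff_right)

lemma energy_inner_sum_left:
  assumes "linear L"
  shows "energy_inner L (\<Sum>i\<in>I. f i) z = (\<Sum>i\<in>I. energy_inner L (f i) z)"
  using assms by (simp add: energy_inner_def linear_sum inner_sum_left)

lemma energy_inner_sum_right: "energy_inner L z (\<Sum>i\<in>I. f i) = (\<Sum>i\<in>I. energy_inner L z (f i))"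
  by (simp add: energy_inner_def inner_sum_right)

section \<open>Orthogonal projections and adjoints on a subspace\<close>

text \<open>Existence is the orthogonal decomposition of \<open>g\<close>; uniqueness follows by
  testing the difference of two candidates with itself. Inner-product projections and adjoints are
  well defined because of it.\<close>

lemma subspace_ex1_inner:
  fixes W :: "'a::euclidean_space set"
  assumes "subspace W"
  shows "\<exists>!w. w \<in> W \<and> (\<forall>v\<in>W. w \<bullet> v = g \<bullet> v)"
proof -
  obtain y z where yz: "y \<in> span W" "\<And>w. w \<in> span W \<Longrightarrow> orthogonal z w" "g = y + z"
    using orthogonal_subspace_decomp_exists[of W g] by blast
  have "w = w'" if "w \<in> W" "w' \<in> W" "\<forall>v\<in>W. w \<bullet> v = g \<bullet> v" "\<forall>v\<in>W. w' \<bullet> v = g \<bullet> v" for w w'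
  proof -
    have "w - w' \<in> W" using that assms subspace_diff by blast
    then have "(w - w') \<bullet> (w - w') = 0" using that by (simp add: inner_diff_left)
    then show ?thesis by simp
  qed
  moreover have "y \<in> W" "\<forall>v\<in>W. y \<bullet> v = g \<bullet> v"
    using yz span_eq_iff[THEN iffD2, OF assms] by (auto simp: orthogonal_def inner_add_left)
  ultimately show ?thesis by blast
qed

lemma inner_proj_works:
  assumes "subspace W"
  shows "orth_proj inner W g \<in> W" and "v \<in> W \<Longrightarrow> orth_proj inner W g \<bullet> v = g \<bullet> v"
proof -
  have eq: "(\<forall>v\<in>W. (g - w) \<bullet> v = 0) \<longleftrightarrow> (\<forall>v\<in>W. w \<bullet> v = g \<bullet> v)" for w
    by (auto simp: inner_diff_left)
  show "orth_proj inner W g \<in> W" "v \<in> W \<Longrightarrow> orth_proj inner W g \<bullet> v = g \<bullet> v"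
    using theI'[OF subspace_ex1_inner[OF assms, of g]] unfolding orth_proj_def eq by blast+
qed

lemma inner_proj_eqI:
  assumes "subspace W" "w \<in> W" "\<And>v. v \<in> W \<Longrightarrow> w \<bullet> v = g \<bullet> v"
  shows "orth_proj inner W g = w"
  using subspace_ex1_inner[OF assms(1), of g] inner_proj_works[OF assms(1)] assms(2,3) by blast

lemma inner_proj_id: "subspace W \<Longrightarrow> w \<in> W \<Longrightarrow> orth_proj inner W w = w"
  by (simp add: inner_proj_eqI)

lemma linear_inner_proj:
  assumes "subspace W"
  shows "linear (orth_proj inner W)"
proof (rule linearI)
  show "orth_proj inner W (x + y) = orth_proj inner W x + orth_proj inner W y" for x y
    by (rule inner_proj_eqI) (simp_all add: assms inner_proj_works subspace_add inner_add_left)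
  show "orth_proj inner W (c *\<^sub>R x) = c *\<^sub>R orth_proj inner W x" for c x
    by (rule inner_proj_eqI) (simp_all add: assms inner_proj_works subspace_scale)
qed

text \<open>Extends an operator given on \<open>W\<close> to the whole space, so that facts on
  adjoints and continuity of globally linear maps apply.\<close>

lemma linear_on_comp_inner_proj:
  assumes "subspace W" "linear_on W T"
  shows "linear (\<lambda>x. T (orth_proj inner W x))"
proof (rule linearI)
  note lin = linear_inner_proj[OF assms(1)] and mem = inner_proj_works(1)[OF assms(1)]
  show "T (orth_proj inner W (x + y)) = T (orth_proj inner W x) + T (orth_proj inner W y)" for x y
    using assms(2) mem unfolding linear_on_def linear_add[OF lin] by blast
  show "T (orth_proj inner W (c *\<^sub>R x)) = c *\<^sub>R T (orth_proj inner W x)" for c x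
    using assms(2) mem unfolding linear_on_def linear_scale[OF lin] by blast
qed

text \<open>The adjoint of the global extension of \<open>T\<close> represents the functional in
  question on \<open>W\<close>; \<open>subspace_ex1_inner\<close> then supplies its unique
  representative in \<open>W\<close>.\<close>

lemma adjoint_on_works:
  assumes W: "subspace W" and T: "linear_on W T"
  shows "adjoint_on W T y \<in> W" and "x \<in> W \<Longrightarrow> T x \<bullet> y = x \<bullet> adjoint_on W T y"
proof -
  let ?g = "adjoint (\<lambda>x. T (orth_proj inner W x)) y"
  have eq: "T x \<bullet> y = ?g \<bullet> x" if "x \<in> W" for x
    using adjoint_works[OF linear_on_comp_inner_proj[OF W T], of x y] inner_proj_id[OF W that]
    by (simp only: inner_commute[of ?g x])
  have "(\<forall>x\<in>W. T x \<bullet> y = x \<bullet> z) \<longleftrightarrow> (\<forall>x\<in>W. z \<bullet> x = ?g \<bullet> x)" for z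
    using eq by (metis inner_commute)
  then have "\<exists>!z. z \<in> W \<and> (\<forall>x\<in>W. T x \<bullet> y = x \<bullet> z)"
    using subspace_ex1_inner[OF W, of ?g] by (simp only:)
  from theI'[OF this] show "adjoint_on W T y \<in> W" "x \<in> W \<Longrightarrow> T x \<bullet> y = x \<bullet> adjoint_on W T y"
    unfolding adjoint_on_def by auto
qed

text \<open>The defining relation of A_k describes a projection; the resulting formula Q_k A is
  linear on the whole space.\<close>

lemma level_op_eq: "level_op A V k u = orth_proj inner (V k) (A u)"
proof -
  have "(\<forall>v\<in>V k. (A u - w) \<bullet> v = 0) \<longleftrightarrow> (\<forall>v\<in>V k. w \<bullet> v = A u \<bullet> v)" for w
    by (auto simp: inner_diff_left)
  then show ?thesis unfolding level_op_def orth_proj_def energy_inner_def by simp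
qed

section \<open>SPD operators on a subspace\<close>

text \<open>Global linearity with symmetry and positivity on \<open>W\<close> only fits Q_k A, which
  in general is neither symmetric nor injective on the whole space.\<close>

locale spd_on =
  fixes W :: "'a::euclidean_space set" and L :: "'a \<Rightarrow> 'a"
  assumes subspace: "subspace W"
    and linear: "linear L"
    and maps: "x \<in> W \<Longrightarrow> L x \<in> W"
    and sym: "x \<in> W \<Longrightarrow> y \<in> W \<Longrightarrow> L x \<bullet> y = x \<bullet> L y"
    and pos: "x \<in> W \<Longrightarrow> x \<noteq> 0 \<Longrightarrow> 0 < L x \<bullet> x"
begin

abbreviation a where "a \<equiv> energy_inner L"

lemmas bilin = energy_inner_linear[OF linear]

lemma a_commute: "x \<in> W \<Longrightarrow> y \<in> W \<Longrightarrow> a x y = a y x"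
  using sym[of x y] by (simp add: energy_inner_def inner_commute)

lemma a_pos: "x \<in> W \<Longrightarrow> x \<noteq> 0 \<Longrightarrow> 0 < a x x"
  by (simp add: energy_inner_def pos)

lemma a_nonneg: "x \<in> W \<Longrightarrow> 0 \<le> a x x"
  using a_pos[of x] by (cases "x = 0") (auto simp: bilin)

lemma energy_norm_sq: "x \<in> W \<Longrightarrow> (energy_norm L x)\<^sup>2 = a x x"
  by (simp add: energy_norm_def a_nonneg)

lemma a_young: "x \<in> W \<Longrightarrow> y \<in> W \<Longrightarrow> 2 * a x y \<le> a x x + a y y"
  using a_nonneg[OF subspace_diff[OF subspace], of x y] a_commute[of x y] by (simp add: bilin)

lemma bij: "bij_betw L W W"
proof -
  have inj: "inj_on L W"
  proof (rule inj_onI)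
    fix x y assume *: "x \<in> W" "y \<in> W" "L x = L y"
    then have "a (x - y) (x - y) = 0" by (simp add: energy_inner_def linear_diff[OF linear])
    then show "x = y" using a_pos[of "x - y"] subspace_diff[OF subspace *(1,2)] by auto
  qed
  have "dim (L ` W) = dim W"
    using dim_image_eq[OF linear, of W] inj span_eq_iff[of W] subspace by metis
  then have "L ` W = W"
    using subspace_dim_equal[of "L ` W" W] linear_subspace_image[OF linear subspace] subspace maps
    by auto
  with inj show ?thesis by (simp add: bij_betw_def)
qed

section \<open>Contraction of the smoothers\<close>

text \<open>A real supremum bounds its members only once the quotients are known to be bounded
  above. Compactness of the unit sphere of \<open>W\<close> and homogeneity give this.\<close>

lemma onorm_on_contraction:
  assumes T: "linear_on W T" and less: "onorm_on W (energy_norm L) T < 1" and v: "v \<in> W"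
  shows "a (T v) (T v) \<le> a v v"
proof (cases "v = 0")
  case True
  have "T 0 = 0" using T subspace_0[OF subspace]
    by (metis linear_on_def scale_zero_left)
  with True show ?thesis by simp
next
  case False
  let ?q = "\<lambda>x. energy_norm L (T x) / energy_norm L x"
  let ?S = "W \<inter> sphere 0 1"
  have npos: "0 < energy_norm L x" if "x \<in> W" "x \<noteq> 0" for x
    using that by (simp add: energy_norm_def a_pos)
  \<comment> \<open>\<open>T\<close> is linear only on \<open>W\<close>; continuity comes from its
    extension, which agrees with \<open>T\<close> there.\<close>
  have cT: "continuous_on ?S T"
    using linear_continuous_on_compose[OF continuous_on_id linear_on_comp_inner_proj[OF subspace T], of ?S]
    by (rule continuous_on_eq) (simp add: inner_proj_id subspace)
  have cn: "continuous_on ?S (\<lambda>x. energy_norm L (f x))" if "continuous_on ?S f" for f :: "'a \<Rightarrow> 'a"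
    unfolding energy_norm_def energy_inner_def
    by (intro continuous_intros linear_continuous_on_compose[OF _ linear] that)
  have "energy_norm L x \<noteq> 0" if "x \<in> ?S" for x
    using npos[of x] that by fastforce
  then have "continuous_on ?S ?q"
    by (intro continuous_on_divide cn cT continuous_on_id ballI)
  moreover have "compact ?S"
    using closed_subspace[OF subspace] by (simp add: closed_Int_compact)
  ultimately have "bdd_above (?q ` ?S)"
    by (intro bounded_imp_bdd_above compact_imp_bounded compact_continuous_image)
  then obtain M where M: "\<And>x. x \<in> ?S \<Longrightarrow> ?q x \<le> M"
    unfolding bdd_above_def by blast
  \<comment> \<open>The \<open>0\<close> covers the zero vector, whose quotient is \<open>0\<close>;
    other vectors are scaled to the sphere.\<close>
  have "?q x \<le> max M 0" if "x \<in> W" for x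
  proof (cases "x = 0")
    case True
    then show ?thesis by (simp add: energy_norm_def bilin)
  next
    case False
    let ?c = "inverse (norm x)"
    have "?q (?c *\<^sub>R x) = ?q x"
      using False that T
      by (simp add: linear_on_def energy_norm_def bilin real_sqrt_mult)
    moreover have "?c *\<^sub>R x \<in> ?S" using False that subspace by (simp add: subspace_scale)
    ultimately show ?thesis using M by (metis max.coboundedI1)
  qed
  then have "bdd_above (?q ` W)" by (auto simp: bdd_above_def)
  then have "?q v < 1" using less v unfolding onorm_on_def by (meson cSUP_upper le_less_trans)
  then have "energy_norm L (T v) < energy_norm L v" using npos[OF v False] by simp
  then show ?thesis by (simp add: energy_norm_def)
qed

text \<open>With \<open>T = I - M L\<close> the adjoint in the energy inner product is \<open>T* = I - M\<^sup>t L\<close>, and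
  \<open>\<parallel>T* x\<parallel>\<^sup>2 = (x, T T* x)\<close> is at most \<open>(\<parallel>x\<parallel>\<^sup>2 + \<parallel>T* x\<parallel>\<^sup>2) / 2\<close> when \<open>T\<close> is a contraction.\<close>

lemma adjoint_smoother_contraction:
  assumes M: "linear_on W M"
    and contr: "\<And>v. v \<in> W \<Longrightarrow> a (v - M (L v)) (v - M (L v)) \<le> a v v"
    and x: "x \<in> W"
  defines "y \<equiv> x - adjoint_on W M (L x)"
  shows "a y y \<le> a x x"
proof -
  let ?Ty = "y - M (L y)"
  have M_mem: "M (L z) \<in> W" if "z \<in> W" for z using M that maps by (auto simp: linear_on_def)
  have adj: "adjoint_on W M (L x) \<in> W" by (rule adjoint_on_works[OF subspace M])
  then have y: "y \<in> W" unfolding y_def using x subspace_diff[OF subspace] by blast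
  then have Ty: "?Ty \<in> W" using M_mem subspace_diff[OF subspace] by blast
  have "a (adjoint_on W M (L x)) y = adjoint_on W M (L x) \<bullet> L y"
    unfolding energy_inner_def by (rule sym[OF adj y])
  also have "\<dots> = M (L y) \<bullet> L x"
    using adjoint_on_works(2)[OF subspace M maps[OF y]] by (simp add: inner_commute)
  also have "\<dots> = a x (M (L y))" by (simp add: energy_inner_def inner_commute)
  finally have "a y y = a x ?Ty" by (subst (1) y_def) (simp add: bilin)
  then show ?thesis using a_young[OF x Ty] contr[OF y] by simp
qed

section \<open>Error reduction by nonlinear PCG\<close>

text \<open>The new error is energy-orthogonal to all directions used so far, and differs from
  \<open>e\<^sub>i - B r\<^sub>i\<close> by a combination of them.\<close>

context
  fixes B :: "'a \<Rightarrow> 'a" and v :: 'a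
  assumes B: "\<And>f. f \<in> W \<Longrightarrow> B f \<in> W" and v: "v \<in> W"
begin

abbreviation "u \<equiv> pcg_iter L B (L v)"
abbreviation "r \<equiv> pcg_res L B (L v)"
abbreviation "p \<equiv> pcg_dir L B (L v)"

text \<open>The residual identity puts \<open>r i\<close> into \<open>W\<close>; membership of the
  earlier directions then puts \<open>p i\<close> there.\<close>

lemma pcg_invariant: "u i \<in> W \<and> (\<forall>j<i. p j \<in> W) \<and> r i = L (v - u i)"
proof (induction i)
  case 0
  then show ?case using subspace_0[OF subspace] by simp
next
  case (Suc i)
  then have "r i \<in> W" using maps subspace_diff[OF subspace v] by auto
  then have "p i \<in> W" unfolding pcg_dir.simps[of L B "L v" i]
    using Suc B subspace by (intro subspace_add subspace_sum subspace_scale) auto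
  then show ?case
    using Suc subspace
    by (auto simp: less_Suc_eq subspace_add subspace_scale linear_diff[OF linear]
        linear_add[OF linear] linear_scale[OF linear])
qed

lemma pcg_dir_mem: "p i \<in> W" using pcg_invariant[of "Suc i"] by simp
lemma pcg_iter_mem: "u i \<in> W" using pcg_invariant by simp
lemma pcg_err_mem: "v - u i \<in> W" by (simp add: pcg_iter_mem v subspace subspace_diff)
lemma pcg_res_eq: "r i = L (v - u i)" using pcg_invariant by simp

text \<open>This is full Gram-Schmidt in the energy product, which works for any map
  \<open>B\<close> of \<open>W\<close> into itself.\<close>

lemma pcg_dir_orth: "j < i \<Longrightarrow> a (p i) (p j) = 0"
proof (induction i arbitrary: j rule: less_induct)
  case (less i)
  let ?b = "\<lambda>l. - a (B (r i)) (p l) / a (p l) (p l)"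
  have 0: "a (p l) (p j) = 0" if "l < i" "l \<noteq> j" for l
  proof (cases "l < j")
    case True
    then have "a (p j) (p l) = 0" using less by simp
    then show ?thesis by (simp add: a_commute pcg_dir_mem)
  qed (use less that in auto)
  have "a (p i) (p j) = a (B (r i)) (p j) + (\<Sum>l<i. ?b l * a (p l) (p j))"
    by (subst pcg_dir.simps) (simp only: bilin energy_inner_sum_left[OF linear])
  also have "(\<Sum>l<i. ?b l * a (p l) (p j)) = (\<Sum>l\<in>{j}. ?b l * a (p l) (p j))"
    using less.prems 0 by (intro sum.mono_neutral_right) auto
  also have "a (B (r i)) (p j) + \<dots> = 0"
    using a_pos[OF pcg_dir_mem, of j] by (cases "p j = 0") (auto simp: bilin)
  finally show ?case .
qed

text \<open>The step length is the energy projection coefficient of the error along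
  \<open>p i\<close>; mutual orthogonality of the directions preserves what earlier steps
  achieved.\<close>

lemma pcg_err_orth: "j < i \<Longrightarrow> a (v - u i) (p j) = 0"
proof (induction i)
  case (Suc i)
  let ?al = "(r i \<bullet> p i) / a (p i) (p i)"
  have eq: "a (v - u (Suc i)) (p j) = a (v - u i) (p j) - ?al * a (p i) (p j)"
    by (simp add: bilin)
  show ?case
  proof (cases "j = i")
    case True
    have "r i \<bullet> p i = a (v - u i) (p i)" by (simp add: pcg_res_eq energy_inner_def)
    then show ?thesis using eq True a_pos[OF pcg_dir_mem, of i]
      by (cases "p i = 0") (auto simp: bilin)
  next
    case False
    then show ?thesis using eq Suc pcg_dir_orth[of j i] by simp
  qed
qed simp

lemma pcg_err_Suc_le:
  "a (v - u (Suc i)) (v - u (Suc i)) \<le> a ((v - u i) - B (L (v - u i))) ((v - u i) - B (L (v - u i)))"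
proof -
  let ?al = "(r i \<bullet> p i) / a (p i) (p i)"
  let ?b = "\<lambda>l. - a (B (r i)) (p l) / a (p l) (p l)"
  let ?e = "v - u (Suc i)"
  \<comment> \<open>The new error is the old one minus \<open>?al\<close> times \<open>p i\<close>,
    and \<open>B (r i)\<close> is \<open>p i\<close> minus the \<open>?b\<close>-sum; hence the
    factor \<open>?al - 1\<close>.\<close>
  define z where "z = (?al - 1) *\<^sub>R p i + (\<Sum>j<i. ?b j *\<^sub>R p j)"
  have z: "z \<in> W" unfolding z_def
    by (intro subspace_add subspace_sum subspace_scale subspace pcg_dir_mem)
  have split: "(v - u i) - B (L (v - u i)) = ?e + z"
    unfolding z_def pcg_res_eq[symmetric]
    using pcg_dir.simps[of L B "L v" i] by (simp add: algebra_simps)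
  have "a ?e z = 0"
    using pcg_err_orth[of _ "Suc i"]
    by (simp only: z_def bilin(4,6) energy_inner_sum_right) (simp del: pcg_iter.simps)
  then have "a (?e + z) (?e + z) = a ?e ?e + a z z"
    using a_commute[OF pcg_err_mem z, of "Suc i"] by (simp only: bilin)
  then show ?thesis unfolding split using a_nonneg[OF z] by linarith
qed

end

lemma nonlinear_pcg_mem:
  assumes "\<And>f. f \<in> W \<Longrightarrow> B f \<in> W" "f \<in> W"
  shows "nonlinear_pcg n L B f \<in> W"
proof -
  \<comment> \<open>Every right-hand side in \<open>W\<close> has the form \<open>L v\<close> in
    which PCG was analysed.\<close>
  obtain v where "v \<in> W" "f = L v" using bij assms(2) by (auto simp: bij_betw_def)
  then show ?thesis using pcg_iter_mem[OF assms(1)] by (simp add: nonlinear_pcg_def)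
qed

text \<open>In each step \<open>B\<close> acts on \<open>L\<close> of the current error, so its
  bound applies anew to that error and gains one factor \<delta>.\<close>

lemma nonlinear_pcg_contraction:
  assumes B: "\<And>f. f \<in> W \<Longrightarrow> B f \<in> W" and "0 \<le> \<delta>"
    and contr: "\<And>v. v \<in> W \<Longrightarrow> a (v - B (L v)) (v - B (L v)) \<le> \<delta> * a v v"
    and v: "v \<in> W"
  shows "a (v - nonlinear_pcg n L B (L v)) (v - nonlinear_pcg n L B (L v)) \<le> \<delta> ^ n * a v v"
proof (induction n)
  case 0
  then show ?case by (simp add: nonlinear_pcg_def)
next
  case (Suc n)
  let ?e = "\<lambda>i. v - pcg_iter L B (L v) i"
  have "a (?e (Suc n)) (?e (Suc n)) \<le> a (?e n - B (L (?e n))) (?e n - B (L (?e n)))"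
    by (rule pcg_err_Suc_le[OF B v])
  also have "\<dots> \<le> \<delta> * a (?e n) (?e n)" by (intro contr pcg_err_mem[OF B v])
  also have "\<dots> \<le> \<delta> * (\<delta> ^ n * a v v)"
    using Suc \<open>0 \<le> \<delta>\<close> by (intro mult_left_mono) (simp_all add: nonlinear_pcg_def)
  finally show ?case by (simp add: nonlinear_pcg_def mult.assoc)
qed

end

section \<open>Level operators and energy projections\<close>

lemma spd_on_level_op:
  assumes A: "SPD A" and V: "subspace (V k)"
  shows "spd_on (V k) (level_op A V k)"
proof (rule spd_on.intro)
  have lin: "linear A" using A by (simp add: SPD_def)
  have "level_op A V k = orth_proj inner (V k) \<circ> A" by (simp add: fun_eq_iff level_op_eq)
  then show "linear (level_op A V k)"
    using linear_compose[OF lin linear_inner_proj[OF V]] by simp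
  have dual: "level_op A V k x \<bullet> y = A x \<bullet> y" if "y \<in> V k" for x y
    using that V by (simp add: level_op_eq inner_proj_works)
  show "level_op A V k x \<bullet> y = x \<bullet> level_op A V k y" if "x \<in> V k" "y \<in> V k" for x y
    using dual[OF that(1), of y] dual[OF that(2), of x] A by (simp add: SPD_def inner_commute)
  show "0 < level_op A V k x \<bullet> x" if "x \<in> V k" "x \<noteq> 0" for x
    using dual[OF that(1), of x] that(2) A unfolding SPD_def by metis
qed (simp_all add: V level_op_eq inner_proj_works)

lemma energy_inner_level_op:
  "subspace (V k) \<Longrightarrow> y \<in> V k \<Longrightarrow> energy_inner (level_op A V k) x y = energy_inner A x y"
  by (simp add: energy_inner_def level_op_eq inner_proj_works)

text \<open>Energy orthogonality is equivalent to the Galerkin equation \<open>?L w = ?L x\<close>,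
  uniquely solvable in \<open>W\<close> by bijectivity.\<close>

lemma energy_proj_works:
  assumes A: "SPD A" and W: "subspace W"
  shows "orth_proj (energy_inner A) W x \<in> W"
    and "y \<in> W \<Longrightarrow> energy_inner A (x - orth_proj (energy_inner A) W x) y = 0"
proof -
  \<comment> \<open>A constant family with dummy level \<open>0\<close> expresses the compression of
    \<open>A\<close> to the single subspace \<open>W\<close>.\<close>
  let ?L = "level_op A (\<lambda>_. W) 0"
  interpret spd_on W ?L using spd_on_level_op[OF A, of "\<lambda>_. W" 0] W by simp
  have "?L x \<in> W" by (simp add: level_op_eq inner_proj_works W)
  then obtain w where w: "w \<in> W" "?L w = ?L x" using bij unfolding bij_betw_def by (metis imageE)
  have iff: "(\<forall>y\<in>W. energy_inner A (x - w') y = 0) \<longleftrightarrow> ?L w' = ?L x" for w'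
  proof
    assume *: "\<forall>y\<in>W. energy_inner A (x - w') y = 0"
    show "?L w' = ?L x" unfolding level_op_eq
      by (rule inner_proj_eqI)
        (use * A W in \<open>auto simp: inner_proj_works energy_inner_def SPD_def linear_diff inner_diff_left\<close>)
  next
    assume "?L w' = ?L x"
    then have "?L (x - w') = 0" by (simp add: linear_diff[OF linear])
    then show "\<forall>y\<in>W. energy_inner A (x - w') y = 0"
      using energy_inner_level_op[of "\<lambda>_. W" 0 _ A "x - w'"] W by (simp add: energy_inner_def)
  qed
  have "\<exists>!w. w \<in> W \<and> (\<forall>y\<in>W. energy_inner A (x - w) y = 0)"
    unfolding iff using w bij by (auto simp: bij_betw_def inj_on_def)
  from theI'[OF this] show "orth_proj (energy_inner A) W x \<in> W"
    "y \<in> W \<Longrightarrow> energy_inner A (x - orth_proj (energy_inner A) W x) y = 0"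
    unfolding orth_proj_def by auto
qed

text \<open>Both sides represent the functional y -> (w, y)_A on \<open>V j\<close>. So the
  restricted residual poses a coarse problem whose exact solution is the energy projection of
  \<open>w\<close>.\<close>

lemma inner_proj_level_op:
  assumes A: "SPD A" and "subspace (V j)" "subspace (V k)" "V j \<subseteq> V k"
  shows "orth_proj inner (V j) (level_op A V k w)
    = level_op A V j (orth_proj (energy_inner A) (V j) w)"
proof (rule inner_proj_eqI)
  let ?P = "orth_proj (energy_inner A) (V j) w"
  fix y assume y: "y \<in> V j"
  have "A (w - ?P) \<bullet> y = 0" using energy_proj_works(2)[OF A assms(2) y] by (simp add: energy_inner_def)
  then show "level_op A V j ?P \<bullet> y = level_op A V k w \<bullet> y"
    using A assms y by (auto simp: level_op_eq inner_proj_works SPD_def linear_diff inner_diff_left)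
qed (use assms in \<open>simp_all add: level_op_eq inner_proj_works\<close>)

section \<open>The AMLI recursion\<close>

lemma amli_1: "amli A V R n (Suc 0) = inv_into (V 1) (level_op A V 1)"
  by (subst amli.simps) simp

text \<open>Here \<open>k\<close> is the coarse level. The residual after pre-smoothing is
  \<open>L w\<close>, with restriction \<open>level_op A V k x\<close>, so PCG approximates
  \<open>x\<close>. Inserting \<open>x\<close> into the error \<open>e\<close> prepares its
  orthogonal splitting.\<close>

lemma amli_step:
  fixes n :: nat
  assumes A: "SPD A" and V: "subspace (V k)" "subspace (V (Suc k))" "V k \<subseteq> V (Suc k)" and k: "1 \<le> k"
    and v: "v \<in> V (Suc k)" and R: "linear_on (V (Suc k)) (R (Suc k))"
  defines "L \<equiv> level_op A V (Suc k)"
  defines "w \<equiv> v - R (Suc k) (L v)"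
  defines "x \<equiv> orth_proj (energy_inner A) (V k) w"
  defines "e \<equiv> (w - x) + (x - amli_pcg A V R n k (level_op A V k x))"
  shows "v - amli A V R n (Suc k) (L v) = e - adjoint_on (V (Suc k)) (R (Suc k)) (L e)"
proof -
  interpret spd_on "V (Suc k)" L unfolding L_def by (rule spd_on_level_op[where V = V, OF A V(2)])
  have "L v - L (R (Suc k) (L v)) = L w" by (simp add: w_def linear_diff[OF linear])
  moreover have "orth_proj inner (V k) (L w) = level_op A V k x"
    unfolding x_def L_def by (rule inner_proj_level_op[where V = V, OF A V])
  ultimately have "amli A V R n (Suc k) (L v) =
      (let u2 = R (Suc k) (L v) + amli_pcg A V R n k (level_op A V k x)
       in u2 + adjoint_on (V (Suc k)) (R (Suc k)) (L v - L u2))"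
    using k by (subst amli.simps) (simp add: Let_def amli_pcg_def L_def)
  moreover have "L v - L (R (Suc k) (L v) + amli_pcg A V R n k (level_op A V k x)) = L e"
    unfolding linear_diff[OF linear, symmetric] by (simp add: e_def w_def algebra_simps)
  ultimately show ?thesis by (simp add: Let_def e_def w_def)
qed

text \<open>The PCG estimates ask for a preconditioner that maps the level space into
  itself.\<close>

lemma amli_mem:
  assumes A: "SPD A" and V: "\<And>k. k \<in> {1..J} \<Longrightarrow> subspace (V k)"
    and nested: "\<And>k. k \<in> {1..<J} \<Longrightarrow> V k \<subseteq> V (Suc k)"
    and R: "\<And>k. k \<in> {2..J} \<Longrightarrow> linear_on (V k) (R k)"
    and k: "1 \<le> k" "k \<le> J" and f: "f \<in> V k"
  shows "amli A V R n k f \<in> V k"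
  using k f
proof (induction k arbitrary: f rule: dec_induct)
  case base
  then have "1 \<in> {1..J}" by simp
  then interpret spd_on "V 1" "level_op A V 1"
    by (intro spd_on_level_op[where V = V] A V)
  have "inv_into (V 1) (level_op A V 1) f \<in> V 1"
    using base(2) bij by (intro inv_into_into) (simp only: bij_betw_def)
  then show ?case by (simp add: amli_1)
next
  case (step k)
  then have k: "k \<in> {1..J}" "Suc k \<in> {1..J}" "Suc k \<in> {2..J}" "k \<in> {1..<J}" "k \<le> J" by auto
  interpret spd_on "V k" "level_op A V k" by (rule spd_on_level_op[where V = V, OF A V[OF k(1)]])
  have pcg: "nonlinear_pcg n (level_op A V k) (amli A V R n k) (orth_proj inner (V k) g) \<in> V (Suc k)" for g
    by (intro subsetD[OF nested[OF k(4)]] nonlinear_pcg_mem step.IH[OF k(5)]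
        inner_proj_works(1)[OF V[OF k(1)]])
  have "R (Suc k) f \<in> V (Suc k)" using R[OF k(3)] step.prems by (auto simp: linear_on_def)
  moreover have "\<not> Suc k \<le> 1" using k(1) by simp
  ultimately show ?case
    by (subst amli.simps)
      (simp only: if_False Let_def diff_Suc_1 subspace_add[OF V[OF k(2)]] pcg
        adjoint_on_works(1)[OF V[OF k(2)] R[OF k(3)]])
qed

section \<open>Existence of \<delta>\<close>

text \<open>The function \<open>?g\<close> vanishes at 1, where its derivative n (1 - c) - 1 is
  positive; hence it is negative just left of 1.\<close>

lemma delta_exists:
  fixes c :: real
  assumes "c < 1" "1 / (1 - c) < real n"
  shows "\<exists>\<delta>. 0 \<le> \<delta> \<and> \<delta> < 1 \<and> (1 - \<delta> ^ n) * c + \<delta> ^ n \<le> \<delta>"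
proof -
  let ?g = "\<lambda>x::real. (1 - x ^ n) * c + x ^ n - x"
  have "(?g has_real_derivative real n * (1 - c) - 1) (at 1)"
    by (auto intro!: derivative_eq_intros simp: algebra_simps)
  moreover have "0 < real n * (1 - c) - 1" using assms by (simp add: field_simps)
  ultimately obtain d where d: "0 < d" "\<And>h. 0 < h \<Longrightarrow> h < d \<Longrightarrow> ?g (1 - h) < ?g 1"
    using DERIV_pos_inc_left[of ?g _ 1] by blast
  \<comment> \<open>Half of \<open>d\<close> stays in the neighbourhood; the cap 1/2 keeps the
    witness nonnegative.\<close>
  let ?x = "1 - min (d / 2) (1 / 2)"
  have "?g ?x < ?g 1" using d(1) by (intro d(2)) auto
  moreover have "0 \<le> ?x" "?x < 1" using d(1) by auto
  ultimately show ?thesis by (intro exI[of _ ?x]) simp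
qed

section \<open>Induction over the levels\<close>

lemma amli_contraction:
  assumes A: "SPD A" and V: "\<And>k. k \<in> {1..J} \<Longrightarrow> subspace (V k)"
    and nested: "\<And>k. k \<in> {1..<J} \<Longrightarrow> V k \<subseteq> V (Suc k)"
    and R: "\<And>k. k \<in> {2..J} \<Longrightarrow> linear_on (V k) (R k)"
    and conv: "\<And>k. k \<in> {2..J} \<Longrightarrow>
       onorm_on (V k) (energy_norm (level_op A V k)) (\<lambda>v. v - R k (level_op A V k v)) < 1"
    and two_grid: "\<And>k v. k \<in> {2..J} \<Longrightarrow> v \<in> V k \<Longrightarrow>
           (let w = v - R k (level_op A V k v)
            in (energy_norm (level_op A V k) (w - orth_proj (energy_inner A) (V (k - 1)) w))\<^sup>2)
             \<le> c * (energy_norm (level_op A V k) v)\<^sup>2"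
    and \<delta>: "0 \<le> \<delta>" "\<delta> < 1" "(1 - \<delta> ^ n) * c + \<delta> ^ n \<le> \<delta>"
    and k: "1 \<le> k" "k \<le> J" and v: "v \<in> V k"
  shows "(energy_norm (level_op A V k) (v - amli A V R n k (level_op A V k v)))\<^sup>2
           \<le> \<delta> * (energy_norm (level_op A V k) v)\<^sup>2 \<and>
         (energy_norm (level_op A V k) (v - amli_pcg A V R n k (level_op A V k v)))\<^sup>2
           \<le> \<delta> ^ n * (energy_norm (level_op A V k) v)\<^sup>2"
proof -
  have spd: "spd_on (V k) (level_op A V k)" if "k \<in> {1..J}" for k
    by (rule spd_on_level_op[where V = V, OF A V[OF that]])
  have mem: "amli A V R n k f \<in> V k" if "k \<in> {1..J}" "f \<in> V k" for k f
  proof (rule amli_mem)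
    show "1 \<le> k" "k \<le> J" using that by auto
  qed (fact A V nested R that(2))+
  let ?a = "\<lambda>k. energy_inner (level_op A V k)"
  let ?E = "\<lambda>k v. v - amli A V R n k (level_op A V k v)"
  let ?F = "\<lambda>k v. v - amli_pcg A V R n k (level_op A V k v)"
  have memE: "?E k v \<in> V k" if "k \<in> {1..J}" "v \<in> V k" for k v
    by (intro subspace_diff V mem spd_on.maps[OF spd] that)
  have memF: "?F k v \<in> V k" if "k \<in> {1..J}" "v \<in> V k" for k v
    unfolding amli_pcg_def
    by (intro subspace_diff V spd_on.nonlinear_pcg_mem[OF spd] mem spd_on.maps[OF spd] that)
  \<comment> \<open>Being conditional on the preconditioner bound of the same level, this lets the
    induction carry the bound for \<open>?E\<close> alone.\<close>
  have F: "?a k (?F k v) (?F k v) \<le> \<delta> ^ n * ?a k v v"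
    if "k \<in> {1..J}" "\<And>v. v \<in> V k \<Longrightarrow> ?a k (?E k v) (?E k v) \<le> \<delta> * ?a k v v" "v \<in> V k" for k v
    unfolding amli_pcg_def
    by (rule spd_on.nonlinear_pcg_contraction[OF spd[OF that(1)] mem[OF that(1)] \<delta>(1) that(2,3)])
  have E: "?a k (?E k v) (?E k v) \<le> \<delta> * ?a k v v" if "v \<in> V k" for v
    using k that
  proof (induction k arbitrary: v rule: dec_induct)
    case base
    then have "?E 1 v = 0"
      using spd_on.bij[OF spd[of 1]] by (simp add: amli_1 bij_betw_def)
    then show ?case
      using spd_on.bilin[OF spd[of 1]] spd_on.a_nonneg[OF spd[of 1]] \<delta>(1) base by simp
  next
    case (step k)
    then have k: "k \<in> {1..J}" "Suc k \<in> {1..J}" "Suc k \<in> {2..J}" "k \<in> {1..<J}" by auto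
    note sub = V[OF k(1)] V[OF k(2)] nested[OF k(4)]
    interpret spd_on "V (Suc k)" "level_op A V (Suc k)" by (rule spd[OF k(2)])
    let ?L = "level_op A V (Suc k)"
    have linA: "linear A" using A by (simp add: SPD_def)
    have RL: "R (Suc k) (?L z) \<in> V (Suc k)" if "z \<in> V (Suc k)" for z
      using R[OF k(3)] maps[OF that] by (auto simp: linear_on_def)
    have T: "linear_on (V (Suc k)) (\<lambda>v. v - R (Suc k) (?L v))"
      using R[OF k(3)] maps subspace_diff[OF subspace] RL
      by (auto simp: linear_on_def linear_add[OF linear] linear_scale[OF linear] algebra_simps)
    note T_contr = onorm_on_contraction[OF T conv[OF k(3)]]
    define w where "w = v - R (Suc k) (?L v)"
    define x where "x = orth_proj (energy_inner A) (V k) w"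
    define d where "d = ?F k x"
    have w: "w \<in> V (Suc k)" unfolding w_def using step.prems(2) RL subspace_diff[OF subspace] by blast
    have x: "x \<in> V k" unfolding x_def by (rule energy_proj_works[OF A sub(1)])
    have d: "d \<in> V k" unfolding d_def by (rule memF[OF k(1) x])
    have x': "x \<in> V (Suc k)" and d': "d \<in> V (Suc k)" using x d sub(3) by auto
    have wx: "w - x \<in> V (Suc k)" by (rule subspace_diff[OF subspace w x'])
    have orth: "a (w - x) y = 0" "a y (w - x) = 0" if "y \<in> V k" for y
    proof -
      have y: "y \<in> V (Suc k)" using that sub(3) by auto
      show "a (w - x) y = 0"
        unfolding energy_inner_level_op[where V = V, OF sub(2) y] x_def by (rule energy_proj_works(2)[OF A sub(1) that])
      then show "a y (w - x) = 0" using a_commute[OF wx y] by simp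
    qed
    \<comment> \<open>The level norms agree on common vectors, so the coarse PCG bound can be read
      in the fine norm.\<close>
    have same: "a y y = ?a k y y" if "y \<in> V k" for y
      using that sub(3) by (simp add: energy_inner_level_op[where V = V, OF sub(1)] energy_inner_level_op[where V = V, OF sub(2)] subsetD)
    have "?a k (?F k x) (?F k x) \<le> \<delta> ^ n * ?a k x x"
      by (rule F[OF k(1) step.IH x]) (use k(1) in auto)
    then have dd: "a d d \<le> \<delta> ^ n * a x x"
      unfolding same[OF d] same[OF x] by (simp only: d_def)
    \<comment> \<open>Pythagoras for w = (w - x) + x, together with contraction of the
      pre-smoother.\<close>
    have ww: "a (w - x) (w - x) + a x x \<le> a v v"
    proof -
      have "a (w - x) (w - x) + a x x = a ((w - x) + x) ((w - x) + x)"
        using orth[OF x] unfolding bilin(1,4) by simp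
      also have "\<dots> \<le> a v v" using T_contr[OF step.prems(2)] by (simp add: w_def)
      finally show ?thesis .
    qed
    have tg: "a (w - x) (w - x) \<le> c * a v v"
      using two_grid[OF k(3) step.prems(2)]
      by (simp add: Let_def energy_norm_sq wx step.prems(2) flip: w_def x_def)
    have "?a (Suc k) (?E (Suc k) v) (?E (Suc k) v) \<le> a ((w - x) + d) ((w - x) + d)"
    proof -
      have "(w - x) + d \<in> V (Suc k)" by (rule subspace_add[OF subspace wx d'])
      moreover have "?E (Suc k) v = ((w - x) + d) - adjoint_on (V (Suc k)) (R (Suc k)) (?L ((w - x) + d))"
        unfolding d_def x_def w_def
        by (rule amli_step[where V = V and R = R, OF A sub step.hyps(1) step.prems(2) R[OF k(3)]])
      ultimately show ?thesis
        using adjoint_smoother_contraction[OF R[OF k(3)] T_contr] by simp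
    qed
    also have "\<dots> = a (w - x) (w - x) + a d d"
      using orth[OF d] unfolding bilin(1,4) by simp
    \<comment> \<open>The first term is split with weights 1 - \<delta>^n and \<delta>^n: one share
      takes the two-grid bound, the other joins \<open>a x x\<close> and is bounded by
      \<open>a v v\<close>. This gives (1 - \<delta>^n) c + \<delta>^n instead of c +
      \<delta>^n.\<close>
    also have "\<dots> \<le> (1 - \<delta> ^ n) * a (w - x) (w - x) + \<delta> ^ n * (a (w - x) (w - x) + a x x)"
      using dd by (simp add: algebra_simps)
    also have "\<dots> \<le> (1 - \<delta> ^ n) * (c * a v v) + \<delta> ^ n * a v v"
      using tg ww \<delta> by (intro add_mono mult_left_mono) (auto simp: power_le_one)
    also have "\<dots> = ((1 - \<delta> ^ n) * c + \<delta> ^ n) * a v v" by (simp add: algebra_simps)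
    also have "\<dots> \<le> \<delta> * a v v" by (intro mult_right_mono \<delta>(3) a_nonneg step.prems(2))
    finally show ?case .
  qed
  have kJ: "k \<in> {1..J}" using k by simp
  show ?thesis
    unfolding spd_on.energy_norm_sq[OF spd[OF kJ] memE[OF kJ v]]
      spd_on.energy_norm_sq[OF spd[OF kJ] memF[OF kJ v]] spd_on.energy_norm_sq[OF spd[OF kJ] v]
    by (rule conjI[OF E[OF v] F[OF kJ E v]])
qed

theorem theorem3p17:
  fixes A :: "'a::euclidean_space \<Rightarrow> 'a"
    and V :: "nat \<Rightarrow> 'a set"
    and R :: "nat \<Rightarrow> 'a \<Rightarrow> 'a"
    and J n :: nat
    and \<delta>bar :: real
  assumes "SPD A"
    and "1 \<le> J"
    and "\<And>k. k \<in> {1..J} \<Longrightarrow> subspace (V k)"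
    and "\<And>k. k \<in> {1..<J} \<Longrightarrow> V k \<subseteq> V (Suc k)"
    and "V J = UNIV"
    and "\<And>k. k \<in> {2..J} \<Longrightarrow> linear_on (V k) (R k)"
    and "\<And>k. k \<in> {2..J} \<Longrightarrow>
           onorm_on (V k) (energy_norm (level_op A V k)) (\<lambda>v. v - R k (level_op A V k v)) < 1"
    and "1 \<le> n"
    and "0 \<le> \<delta>bar" and "\<delta>bar < 1"
    and "\<And>k v. k \<in> {2..J} \<Longrightarrow> v \<in> V k \<Longrightarrow>
           (let w = v - R k (level_op A V k v)
            in (energy_norm (level_op A V k) (w - orth_proj (energy_inner A) (V (k - 1)) w))\<^sup>2)
             \<le> \<delta>bar * (energy_norm (level_op A V k) v)\<^sup>2"
  shows "(real n > 1 / (1 - \<delta>bar) \<longrightarrow>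
            (\<exists>\<delta>. 0 \<le> \<delta> \<and> \<delta> < 1 \<and> (1 - \<delta> ^ n) * \<delta>bar + \<delta> ^ n \<le> \<delta>)) \<and>
         (\<forall>\<delta>. 0 \<le> \<delta> \<and> \<delta> < 1 \<and> (1 - \<delta> ^ n) * \<delta>bar + \<delta> ^ n \<le> \<delta> \<longrightarrow>
            (\<forall>k\<in>{1..J}. \<forall>v\<in>V k.
               (energy_norm (level_op A V k) (v - amli A V R n k (level_op A V k v)))\<^sup>2
                 \<le> \<delta> * (energy_norm (level_op A V k) v)\<^sup>2 \<and>
               (energy_norm (level_op A V k) (v - amli_pcg A V R n k (level_op A V k v)))\<^sup>2
                 \<le> \<delta> ^ n * (energy_norm (level_op A V k) v)\<^sup>2))"
proof (intro conjI impI allI ballI)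
  show "\<exists>\<delta>. 0 \<le> \<delta> \<and> \<delta> < 1 \<and> (1 - \<delta> ^ n) * \<delta>bar + \<delta> ^ n \<le> \<delta>" if "1 / (1 - \<delta>bar) < real n"
    using delta_exists[OF assms(10) that] .
next
  fix \<delta> k v
  assume "0 \<le> \<delta> \<and> \<delta> < 1 \<and> (1 - \<delta> ^ n) * \<delta>bar + \<delta> ^ n \<le> \<delta>" and "k \<in> {1..J}" and v: "v \<in> V k"
  then have \<delta>: "0 \<le> \<delta>" "\<delta> < 1" "(1 - \<delta> ^ n) * \<delta>bar + \<delta> ^ n \<le> \<delta>" and k: "1 \<le> k" "k \<le> J"
    by simp_all
  show "(energy_norm (level_op A V k) (v - amli A V R n k (level_op A V k v)))\<^sup>2
      \<le> \<delta> * (energy_norm (level_op A V k) v)\<^sup>2"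
    by (rule amli_contraction[THEN conjunct1]; fact)
  show "(energy_norm (level_op A V k) (v - amli_pcg A V R n k (level_op A V k v)))\<^sup>2
      \<le> \<delta> ^ n * (energy_norm (level_op A V k) v)\<^sup>2"
    by (rule amli_contraction[THEN conjunct2]; fact)
qed

end
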